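(* Let $\alpha$ be a unit-interval parking function of length $n$ that is parking-ordered, with breakpoints $b_1<b_2<\dots<b_k=n$, and set $b_0=0$. Then $\alpha$ decomposes uniquely as a pipe $\alpha=P_1|P_2|\cdots|P_k$ of prime unit-interval parking functions, where $P_j$ has length $b_j-b_{j-1}$ and equals $(1,1,2,\dots,b_j-b_{j-1}-1)$ (read as $(1)$ when $b_j-b_{j-1}=1$). In particular, unit-interval parking functions are characterized as those parking functions whose component primes are all of the form $(1,1,2,\dots,r-1)$, where $r$ is the length of the component prime.
   Context: A parking function of length $n$ is $\alpha=(a_1,\dots,a_n)\in[n]^n$ such that, when cars $1,\dots,n$ arrive in order on a one-way street with spots $1,\dots,n$ and car $i$ parks in the first unoccupied spot $\ge a_i$, every car parks. Car $i$'s displacement is $s_i-a_i$, where $s_i$ is the spot it parks in. A unit-interval parking function is one where every car has displacement at most $1$. $\alpha$ is parking-ordered if $a_i\le i$ for all $i$. The parking rearrangement of $\alpha$ is the tuple $\alpha'$ with $a'_{s_i}=a_i$ for all $i$; it is parking-ordered. $\alpha$ has a breakpoint at $k$ if $|\{i:a_i\le k\}|=k$; it is prime if its only breakpoint is at $n$. For tuples $A$ of length $m$ and $B=(b_1,\dots,b_\ell)$, the pipe $A|B$ is the concatenation of $A$ with $(b_1+m,\dots,b_\ell+m)$, extended inductively to finitely many tuples. For a parking-ordered parking function with breakpoints $b_1<\dots<b_k=n$ ($b_0=0$), its component primes are the tuples $(a_{b_{j-1}+1}-b_{j-1},\dots,a_{b_j}-b_{j-1})$, $j=1,\dots,k$;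 the component primes of an arbitrary parking function are those of its parking rearrangement. *)

theory Defs
  imports Main
begin

text \<open>
  Tuples \<open>(a\<^sub>1, \<dots>, a\<^sub>n)\<close> are lists, so \<open>a\<^sub>i\<close> is \<open>\<alpha> ! (i - 1)\<close>: the car at list index \<open>i\<close> is
  car \<open>i + 1\<close>.  Parking spots and preferences are numbered from 1.
\<close>

text \<open>
  \<open>park n occ \<alpha>\<close> lists the spots taken by the arriving cars on a street with spots \<open>1, \<dots>, n\<close> of
  which those in \<open>occ\<close> are already occupied; \<open>None\<close> marks a car that leaves without parking.
\<close>

fun park :: "nat \<Rightarrow> nat set \<Rightarrow> nat list \<Rightarrow> nat option list" where
  "park n occ [] = []"
| "park n occ (a # as) =
     (let free = {s \<in> {1..n}. a \<le> s \<and> s \<notin> occ} in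
      if free = {} then None # park n occ as
      else Some (Min free) # park n (insert (Min free) occ) as)"

definition outcome :: "nat list \<Rightarrow> nat option list" where
  "outcome \<alpha> = park (length \<alpha>) {} \<alpha>"

definition parking_function :: "nat list \<Rightarrow> bool" where
  "parking_function \<alpha> \<longleftrightarrow> set \<alpha> \<subseteq> {1..length \<alpha>} \<and> None \<notin> set (outcome \<alpha>)"

definition spot :: "nat list \<Rightarrow> nat \<Rightarrow> nat" where
  "spot \<alpha> i = the (outcome \<alpha> ! i)"

definition displacement :: "nat list \<Rightarrow> nat \<Rightarrow> nat" where
  "displacement \<alpha> i = spot \<alpha> i - \<alpha> ! i"

definition unit_interval_pf :: "nat list \<Rightarrow> bool" where
  "unit_interval_pf \<alpha> \<longleftrightarrow> parking_function \<alpha> \<and> (\<forall>i < length \<alpha>. displacement \<alpha> i \<le> 1)"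

definition parking_ordered :: "nat list \<Rightarrow> bool" where
  "parking_ordered \<alpha> \<longleftrightarrow> (\<forall>i < length \<alpha>. \<alpha> ! i \<le> i + 1)"

definition parking_rearrangement :: "nat list \<Rightarrow> nat list" where
  "parking_rearrangement \<alpha> =
     map (\<lambda>s. \<alpha> ! (THE i. i < length \<alpha> \<and> spot \<alpha> i = s)) [1..<length \<alpha> + 1]"

definition has_breakpoint :: "nat list \<Rightarrow> nat \<Rightarrow> bool" where
  "has_breakpoint \<alpha> k \<longleftrightarrow> k \<in> {1..length \<alpha>} \<and> card {i. i < length \<alpha> \<and> \<alpha> ! i \<le> k} = k"

definition prime_pf :: "nat list \<Rightarrow> bool" where
  "prime_pf \<alpha> \<longleftrightarrow> parking_function \<alpha> \<and> {k. has_breakpoint \<alpha> k} = {length \<alpha>}"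

text \<open>The list \<open>b\<^sub>0, b\<^sub>1, \<dots>, b\<^sub>k\<close> with \<open>b\<^sub>0 = 0\<close>, followed by the breakpoints in increasing order.\<close>

definition breaks :: "nat list \<Rightarrow> nat list" where
  "breaks \<alpha> = 0 # sorted_list_of_set {k. has_breakpoint \<alpha> k}"

definition num_breakpoints :: "nat list \<Rightarrow> nat" where
  "num_breakpoints \<alpha> = card {k. has_breakpoint \<alpha> k}"

definition pipe :: "nat list \<Rightarrow> nat list \<Rightarrow> nat list" where
  "pipe A B = A @ map (\<lambda>b. b + length A) B"

definition pipes :: "nat list list \<Rightarrow> nat list" where
  "pipes Ps = foldr pipe Ps []"

text \<open>
  The subtraction never truncates when \<open>\<alpha>\<close> is a parking-ordered parking function: the \<open>b\<close> entries
  that are at most a breakpoint \<open>b\<close> are then exactly the first \<open>b\<close> entries.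
\<close>

definition ordered_component_primes :: "nat list \<Rightarrow> nat list list" where
  "ordered_component_primes \<alpha> =
     map (\<lambda>j. map (\<lambda>i. \<alpha> ! i - breaks \<alpha> ! j) [breaks \<alpha> ! j..<breaks \<alpha> ! (j + 1)])
       [0..<num_breakpoints \<alpha>]"

definition component_primes :: "nat list \<Rightarrow> nat list list" where
  "component_primes \<alpha> = ordered_component_primes (parking_rearrangement \<alpha>)"

text \<open>\<open>(1, 1, 2, \<dots>, r - 1)\<close> for \<open>r \<ge> 1\<close>, which is \<open>(1)\<close> for \<open>r = 1\<close>.\<close>

definition unit_prime :: "nat \<Rightarrow> nat list" where
  "unit_prime r = 1 # [1..<r]"

definition prime_upf_decomposition :: "nat list \<Rightarrow> nat list list \<Rightarrow> bool" where
  "prime_upf_decomposition \<alpha> Ps \<longleftrightarrow>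
     (\<forall>P \<in> set Ps. prime_pf P \<and> unit_interval_pf P) \<and> \<alpha> = pipes Ps"

end

theory Submission
  imports Defs
begin

text \<open>
  In a parking-ordered parking function car \<open>i\<close> parks in spot \<open>i\<close>, so having displacements at most 1
  means \<open>a\<^sub>i \<in> {i - 1, i}\<close>.  For such a tuple \<open>k < n\<close> is a breakpoint exactly when
  \<open>a\<^sub>k\<^sub>+\<^sub>1 = k + 1\<close>; hence each block between consecutive breakpoints starts on the diagonal and continues
  just below it, which is the shape \<open>(1, 1, 2, \<dots>, r - 1)\<close>.  Displacements are preserved by the
  parking rearrangement, so the general characterization reduces to the parking-ordered case.
\<close>

text \<open>List index \<open>i\<close> is car \<open>i + 1\<close>, so the last two bounds say that
  each preference is the car's own number or one less; \<open>1 \<le> \<alpha> ! i\<close> rules out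
  the preference 0 at index 0.\<close>

definition near_diagonal :: "nat list \<Rightarrow> bool" where
  "near_diagonal \<alpha> \<longleftrightarrow> (\<forall>i < length \<alpha>. 1 \<le> \<alpha> ! i \<and> i \<le> \<alpha> ! i \<and> \<alpha> ! i \<le> i + 1)"

subsection \<open>Parking\<close>

text \<open>The occupied spots always form an initial segment: the next car prefers a spot at most
  \<open>m + 1\<close>, everything before \<open>m + 1\<close> is taken, so it parks exactly there.
  General \<open>m\<close> carries the induction; an empty street is \<open>m = 0\<close>.\<close>

lemma park_ordered:
  assumes "\<forall>i < length as. as ! i \<le> m + i + 1" and "m + length as \<le> n"
  shows "park n {1..m} as = map Some [m + 1..<m + length as + 1]"
  using assms
proof (induction as arbitrary: m)
  case Nil
  then show ?case by simp
next
  case (Cons a as)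
  have a: "a \<le> m + 1" using Cons.prems(1)[rule_format, of 0] by simp
  let ?F = "{s \<in> {1..n}. a \<le> s \<and> s \<notin> {1..m}}"
  have mem: "m + 1 \<in> ?F" using a Cons.prems(2) by simp
  have Min: "Min ?F = m + 1"
    by (rule Min_eqI) (use mem in auto)
  have ins: "insert (m + 1) {1..m} = {1..m + 1}" by auto
  have "park n {1..m + 1} as = map Some [m + 1 + 1..<m + 1 + length as + 1]"
  proof (rule Cons.IH)
    show "\<forall>i<length as. as ! i \<le> m + 1 + i + 1"
    proof (intro allI impI)
      fix i assume "i < length as"
      then show "as ! i \<le> m + 1 + i + 1" using Cons.prems(1)[rule_format, of "Suc i"] by simp
    qed
    show "m + 1 + length as \<le> n" using Cons.prems(2) by simp
  qed
  moreover have "park n {1..m} (a # as) = Some (m + 1) # park n {1..m + 1} as"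
  proof -
    have "?F \<noteq> {}" using mem by blast
    then have "park n {1..m} (a # as) = Some (Min ?F) # park n (insert (Min ?F) {1..m}) as"
      unfolding park.simps Let_def by (rule if_not_P)
    then show ?thesis unfolding Min ins .
  qed
  moreover have "[m + 1..<m + length (a # as) + 1] = (m + 1) # [m + 1 + 1..<m + 1 + length as + 1]"
    by (simp add: upt_conv_Cons del: upt_Suc)
  ultimately show ?case by (simp del: upt_Suc park.simps)
qed

lemma outcome_ordered:
  assumes "parking_ordered \<alpha>"
  shows "outcome \<alpha> = map Some [1..<length \<alpha> + 1]"
  using park_ordered[of \<alpha> 0 "length \<alpha>"] assms
  by (simp add: outcome_def parking_ordered_def)

lemma spot_ordered:
  assumes "parking_ordered \<alpha>" and "i < length \<alpha>"
  shows "spot \<alpha> i = i + 1"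
proof -
  have "outcome \<alpha> ! i = Some ([1..<length \<alpha> + 1] ! i)"
    unfolding outcome_ordered[OF assms(1)] by (rule nth_map) (use assms(2) in simp)
  moreover have "[1..<length \<alpha> + 1] ! i = i + 1"
    using assms(2) by (subst nth_upt) simp_all
  ultimately show ?thesis by (simp add: spot_def)
qed

text \<open>The car at index \<open>i\<close> parks in spot \<open>i + 1\<close>, so displacement at
  most 1 is the lower bound \<open>i \<le> \<alpha> ! i\<close>. Conversely the bounds already make
  \<open>\<alpha>\<close> parking-ordered, and then every car parks.\<close>

lemma unit_interval_ordered_iff_near_diagonal:
  "unit_interval_pf \<alpha> \<and> parking_ordered \<alpha> \<longleftrightarrow> near_diagonal \<alpha>"
proof
  assume *: "unit_interval_pf \<alpha> \<and> parking_ordered \<alpha>"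
  show "near_diagonal \<alpha>"
    unfolding near_diagonal_def
  proof (intro allI impI)
    fix i assume i: "i < length \<alpha>"
    have "\<alpha> ! i \<in> {1..length \<alpha>}"
      using * nth_mem[OF i] unfolding unit_interval_pf_def parking_function_def by blast
    moreover have "\<alpha> ! i \<le> i + 1" using * i by (simp add: parking_ordered_def)
    moreover have "i + 1 - \<alpha> ! i \<le> 1"
      using * i spot_ordered[of \<alpha> i] by (auto simp: unit_interval_pf_def displacement_def)
    ultimately show "1 \<le> \<alpha> ! i \<and> i \<le> \<alpha> ! i \<and> \<alpha> ! i \<le> i + 1" by auto
  qed
next
  assume *: "near_diagonal \<alpha>"
  then have po: "parking_ordered \<alpha>" by (simp add: near_diagonal_def parking_ordered_def)
  have "x \<in> {1..length \<alpha>}" if "x \<in> set \<alpha>" for x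
    using * that by (fastforce simp: near_diagonal_def in_set_conv_nth)
  moreover have "None \<notin> set (outcome \<alpha>)" by (simp add: outcome_ordered[OF po])
  ultimately have "parking_function \<alpha>" unfolding parking_function_def by blast
  moreover have "displacement \<alpha> i \<le> 1" if "i < length \<alpha>" for i
  proof -
    have "i \<le> \<alpha> ! i" using * that by (simp add: near_diagonal_def)
    then show ?thesis using spot_ordered[OF po that] by (simp add: displacement_def)
  qed
  ultimately show "unit_interval_pf \<alpha> \<and> parking_ordered \<alpha>"
    using po by (simp add: unit_interval_pf_def)
qed

section \<open>Spots taken in an arbitrary parking function\<close>

lemma length_park [simp]: "length (park n occ as) = length as"
  by (induction as arbitrary: occ) (simp_all add: Let_def)

text \<open>Each car takes a free spot not before its preference, and that spot counts as occupied
  from then on. The three claims go through one induction because distinctness of the first spot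
  from the later ones comes from the later ones avoiding the enlarged occupied set.\<close>

lemma park_spots:
  assumes "None \<notin> set (park n occ as)"
  shows "set (map the (park n occ as)) \<subseteq> {1..n} - occ"
    and "distinct (map the (park n occ as))"
    and "\<forall>i < length as. as ! i \<le> the (park n occ as ! i)"
proof -
  have "set (map the (park n occ as)) \<subseteq> {1..n} - occ \<and> distinct (map the (park n occ as)) \<and>
    (\<forall>i < length as. as ! i \<le> the (park n occ as ! i))"
    using assms
  proof (induction as arbitrary: occ)
    case Nil
    then show ?case by simp
  next
    case (Cons a as)
    let ?F = "{s \<in> {1..n}. a \<le> s \<and> s \<notin> occ}"
    let ?m = "Min ?F"
    have ne: "?F \<noteq> {}"
    proof
      assume "?F = {}"
      then have "park n occ (a # as) = None # park n occ as"
        unfolding park.simps Let_def by (rule if_P)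
      then show False using Cons.prems by simp
    qed
    then have eq: "park n occ (a # as) = Some ?m # park n (insert ?m occ) as"
      unfolding park.simps Let_def by (rule if_not_P)
    have m: "?m \<in> ?F" by (rule Min_in) (use ne in auto)
    have "None \<notin> set (park n (insert ?m occ) as)" using Cons.prems unfolding eq by simp
    note IH = Cons.IH[OF this]
    have "(a # as) ! i \<le> the ((Some ?m # park n (insert ?m occ) as) ! i)"
      if "i < length (a # as)" for i
      using that IH m by (cases i) auto
    moreover have "set (map the (Some ?m # park n (insert ?m occ) as)) \<subseteq> {1..n} - occ"
      using IH m by auto
    moreover have "distinct (map the (Some ?m # park n (insert ?m occ) as))"
      using IH by auto
    ultimately show ?case unfolding eq by blast
  qed
  then show "set (map the (park n occ as)) \<subseteq> {1..n} - occ"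
    and "distinct (map the (park n occ as))"
    and "\<forall>i < length as. as ! i \<le> the (park n occ as ! i)" by blast+
qed

text \<open>The \<open>n\<close> cars take distinct spots among \<open>{1..n}\<close>, so by
  counting every spot is taken. The second claim ensures that the natural subtraction in
  \<open>displacement\<close> never truncates.\<close>

lemma
  assumes "parking_function \<alpha>"
  shows bij_betw_spot: "bij_betw (spot \<alpha>) {..<length \<alpha>} {1..length \<alpha>}"
    and le_spot: "\<And>i. i < length \<alpha> \<Longrightarrow> \<alpha> ! i \<le> spot \<alpha> i"
proof -
  let ?n = "length \<alpha>"
  have "None \<notin> set (park ?n {} \<alpha>)"
    using assms by (simp add: parking_function_def outcome_def)
  note ps = park_spots[OF this]
  have spots: "spot \<alpha> i = map the (park ?n {} \<alpha>) ! i" if "i < ?n" for i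
    using that by (simp add: spot_def outcome_def)
  show "\<alpha> ! i \<le> spot \<alpha> i" if "i < ?n" for i
    using ps(3) that by (simp add: spot_def outcome_def)
  have inj: "inj_on (spot \<alpha>) {..<?n}"
    using ps(2) spots by (auto intro!: inj_onI simp del: nth_map simp: nth_eq_iff_index_eq)
  have "spot \<alpha> ` {..<?n} \<subseteq> {1..?n}"
  proof
    fix s assume "s \<in> spot \<alpha> ` {..<?n}"
    then obtain i where i: "i < ?n" "s = spot \<alpha> i" by blast
    then have "s \<in> set (map the (park ?n {} \<alpha>))"
      using spots[OF i(1)] nth_mem[of i "map the (park ?n {} \<alpha>)"] by simp
    then show "s \<in> {1..?n}" using ps(1) by blast
  qed
  then have "spot \<alpha> ` {..<?n} = {1..?n}"
    by (intro card_subset_eq) (simp_all add: card_image[OF inj])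
  then show "bij_betw (spot \<alpha>) {..<?n} {1..?n}" using inj by (simp add: bij_betw_def)
qed

section \<open>The parking rearrangement\<close>

lemma length_parking_rearrangement [simp]: "length (parking_rearrangement \<alpha>) = length \<alpha>"
  by (simp add: parking_rearrangement_def del: upt_Suc)

text \<open>Injectivity of \<open>spot \<alpha>\<close> makes the definite description pick the car
  \<open>i\<close> itself; spot \<open>s\<close> sits at list index \<open>s - 1\<close>.\<close>

lemma nth_parking_rearrangement:
  assumes "parking_function \<alpha>" and "i < length \<alpha>"
  shows "parking_rearrangement \<alpha> ! (spot \<alpha> i - 1) = \<alpha> ! i"
proof -
  let ?n = "length \<alpha>"
  have bij: "bij_betw (spot \<alpha>) {..<?n} {1..?n}" by (rule bij_betw_spot[OF assms(1)])
  then have s: "spot \<alpha> i \<in> {1..?n}" using assms(2) by (auto simp: bij_betw_def)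
  have "(THE k. k < ?n \<and> spot \<alpha> k = spot \<alpha> i) = i"
    using bij assms(2) by (intro the_equality) (auto simp: bij_betw_def inj_on_def)
  moreover have "[1..<?n + 1] ! (spot \<alpha> i - 1) = spot \<alpha> i"
    using s by (subst nth_upt) auto
  ultimately show ?thesis
    unfolding parking_rearrangement_def using s by (subst nth_map) auto
qed

text \<open>Surjectivity of \<open>spot \<alpha>\<close> provides the car that parks in spot
  \<open>j + 1\<close>.\<close>

lemma parking_rearrangement_entries:
  assumes "parking_function \<alpha>" and "j < length \<alpha>"
  obtains i where "i < length \<alpha>" and "spot \<alpha> i = j + 1" and "parking_rearrangement \<alpha> ! j = \<alpha> ! i"
proof -
  have "j + 1 \<in> spot \<alpha> ` {..<length \<alpha>}"
    using bij_betw_spot[OF assms(1)] assms(2) by (simp add: bij_betw_def)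
  then obtain i where i: "i < length \<alpha>" "spot \<alpha> i = j + 1" by auto
  then have "parking_rearrangement \<alpha> ! j = \<alpha> ! i"
    using nth_parking_rearrangement[OF assms(1) i(1)] by simp
  with i that show ?thesis by blast
qed

text \<open>No car parks before its preference, so the preference stored at spot
  \<open>j + 1\<close> is at most \<open>j + 1\<close>: the rearrangement is
  parking-ordered.\<close>

lemma parking_rearrangement_bounds:
  assumes "parking_function \<alpha>" and "j < length \<alpha>"
  shows "1 \<le> parking_rearrangement \<alpha> ! j \<and> parking_rearrangement \<alpha> ! j \<le> j + 1"
proof -
  obtain i where i: "i < length \<alpha>" "spot \<alpha> i = j + 1" "parking_rearrangement \<alpha> ! j = \<alpha> ! i"
    using parking_rearrangement_entries[OF assms] .
  moreover have "\<alpha> ! i \<in> {1..length \<alpha>}"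
    using assms(1) nth_mem[OF i(1)] unfolding parking_function_def by blast
  ultimately show ?thesis using le_spot[OF assms(1) i(1)] by simp
qed

text \<open>The rearrangement stores each preference at the position of the spot taken, so a
  displacement becomes the distance of an entry from the diagonal and no longer depends on the order
  of arrival.\<close>

lemma unit_interval_iff_near_diagonal_rearrangement:
  assumes pf: "parking_function \<alpha>"
  shows "unit_interval_pf \<alpha> \<longleftrightarrow> near_diagonal (parking_rearrangement \<alpha>)"
proof
  assume u: "unit_interval_pf \<alpha>"
  show "near_diagonal (parking_rearrangement \<alpha>)"
    unfolding near_diagonal_def length_parking_rearrangement
  proof (intro allI impI)
    fix j assume j: "j < length \<alpha>"
    obtain i where i: "i < length \<alpha>" "spot \<alpha> i = j + 1" "parking_rearrangement \<alpha> ! j = \<alpha> ! i"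
      using parking_rearrangement_entries[OF pf j] .
    have "spot \<alpha> i - \<alpha> ! i \<le> 1"
      using u i(1) by (simp add: unit_interval_pf_def displacement_def)
    then show "1 \<le> parking_rearrangement \<alpha> ! j \<and> j \<le> parking_rearrangement \<alpha> ! j \<and>
        parking_rearrangement \<alpha> ! j \<le> j + 1"
      using parking_rearrangement_bounds[OF pf j] i by auto
  qed
next
  assume *: "near_diagonal (parking_rearrangement \<alpha>)"
  have "displacement \<alpha> i \<le> 1" if i: "i < length \<alpha>" for i
  proof -
    have "spot \<alpha> i \<in> {1..length \<alpha>}"
      using bij_betw_spot[OF pf] i by (auto simp: bij_betw_def)
    then have "spot \<alpha> i - 1 < length \<alpha>" by auto
    then have "spot \<alpha> i - 1 \<le> parking_rearrangement \<alpha> ! (spot \<alpha> i - 1)"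
      using * by (simp add: near_diagonal_def)
    then show ?thesis
      unfolding nth_parking_rearrangement[OF pf i] displacement_def by simp
  qed
  then show "unit_interval_pf \<alpha>" using pf by (simp add: unit_interval_pf_def)
qed

subsection \<open>Breakpoints\<close>

text \<open>Entries at indices below \<open>k\<close> are at most \<open>k\<close>, and those at
  indices above \<open>k\<close> exceed \<open>k\<close>. Only index \<open>k\<close> is undecided:
  the count is \<open>k\<close> if its entry is \<open>k + 1\<close>, or if there is no such index,
  and \<open>k + 1\<close> if its entry is \<open>k\<close>.\<close>

lemma has_breakpoint_near_diagonal:
  assumes "near_diagonal \<alpha>"
  shows "has_breakpoint \<alpha> k \<longleftrightarrow> k \<in> {1..length \<alpha>} \<and> (k = length \<alpha> \<or> \<alpha> ! k = k + 1)"
proof (cases "k \<in> {1..length \<alpha>}")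
  case True
  have b: "i \<le> \<alpha> ! i" "\<alpha> ! i \<le> i + 1" if "i < length \<alpha>" for i
    using assms that by (auto simp: near_diagonal_def)
  show ?thesis
  proof (cases "k = length \<alpha> \<or> \<alpha> ! k = k + 1")
    case yes: True
    have "i < length \<alpha> \<and> \<alpha> ! i \<le> k \<longleftrightarrow> i < k" for i
      using b[of i] yes True by (cases "i = k") auto
    then have "{i. i < length \<alpha> \<and> \<alpha> ! i \<le> k} = {..<k}" by auto
    then show ?thesis using True yes by (simp add: has_breakpoint_def)
  next
    case no: False
    then have k: "k < length \<alpha>" "\<alpha> ! k = k" using True b[of k] by auto
    have "i < length \<alpha> \<and> \<alpha> ! i \<le> k \<longleftrightarrow> i \<le> k" for i
      using b[of i] k by (cases "i = k") auto
    then have "{i. i < length \<alpha> \<and> \<alpha> ! i \<le> k} = {..k}" by auto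
    then show ?thesis using no by (simp add: has_breakpoint_def)
  qed
next
  case False
  then show ?thesis by (auto simp: has_breakpoint_def)
qed

lemma finite_breakpoints [simp]: "finite {k. has_breakpoint \<alpha> k}"
  by (rule finite_subset[of _ "{1..length \<alpha>}"]) (auto simp: has_breakpoint_def)

lemma length_breaks: "length (breaks \<alpha>) = num_breakpoints \<alpha> + 1"
  by (simp add: breaks_def num_breakpoints_def)

text \<open>The bound on the entries makes \<open>length \<alpha>\<close> a breakpoint, so
  \<open>breaks \<alpha>\<close> contains both 0 and \<open>length \<alpha>\<close>, and some
  consecutive pair must straddle \<open>i\<close>.\<close>

lemma between_breaks:
  assumes "\<forall>i < length \<alpha>. \<alpha> ! i \<le> length \<alpha>" and "i < length \<alpha>"
  obtains j where "j < num_breakpoints \<alpha>" and "breaks \<alpha> ! j \<le> i" and "i < breaks \<alpha> ! (j + 1)"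
proof -
  have "{i. i < length \<alpha> \<and> \<alpha> ! i \<le> length \<alpha>} = {..<length \<alpha>}" using assms(1) by auto
  then have "has_breakpoint \<alpha> (length \<alpha>)" using assms(2) by (simp add: has_breakpoint_def)
  then have "length \<alpha> \<in> set (breaks \<alpha>)" by (simp add: breaks_def)
  then obtain m where m: "m < length (breaks \<alpha>)" "breaks \<alpha> ! m = length \<alpha>"
    by (auto simp: in_set_conv_nth)
  \<comment> \<open>A discrete intermediate value argument: the list starts at 0, which is not above
    \<open>i\<close>, and is above \<open>i\<close> at position \<open>m\<close>.\<close>
  have "\<exists>j<m. breaks \<alpha> ! j \<le> i \<and> i < breaks \<alpha> ! (j + 1)" if "i < breaks \<alpha> ! m" for m
    using that
  proof (induction m)
    case 0
    then show ?case by (simp add: breaks_def)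
  next
    case (Suc m)
    show ?case
    proof (cases "i < breaks \<alpha> ! m")
      case True
      then show ?thesis using Suc.IH less_SucI by blast
    next
      case False
      then show ?thesis using Suc.prems by (intro exI[of _ m]) simp
    qed
  qed
  from this[of m] m assms(2) obtain j where
    "j < m" "breaks \<alpha> ! j \<le> i" "i < breaks \<alpha> ! (j + 1)" by auto
  with m(1) that[of j] show ?thesis by (simp add: length_breaks)
qed

subsection \<open>Unit primes\<close>

text \<open>The hypothesis excludes \<open>unit_prime 0\<close>, which is the list
  \<open>[1]\<close>.\<close>

lemma length_unit_prime: "1 \<le> r \<Longrightarrow> length (unit_prime r) = r"
  by (simp add: unit_prime_def)

lemma nth_unit_prime: "i < r \<Longrightarrow> unit_prime r ! i = (if i = 0 then 1 else i)"
  by (simp add: unit_prime_def nth_Cons')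

lemma near_diagonal_unit_prime:
  assumes "1 \<le> r"
  shows "near_diagonal (unit_prime r)"
  using assms by (auto simp: near_diagonal_def length_unit_prime nth_unit_prime)

text \<open>A breakpoint \<open>k < r\<close> would need the entry \<open>k + 1\<close> at index
  \<open>k\<close>, but at a positive index \<open>k\<close> the entry is \<open>k\<close>.\<close>

lemma prime_pf_unit_prime:
  assumes "1 \<le> r"
  shows "prime_pf (unit_prime r)"
proof -
  have "has_breakpoint (unit_prime r) k \<longleftrightarrow> k = r" for k
    using assms
    by (auto simp: has_breakpoint_near_diagonal[OF near_diagonal_unit_prime[OF assms]]
        length_unit_prime nth_unit_prime le_less)
  moreover have "parking_function (unit_prime r)"
    using near_diagonal_unit_prime[OF assms] unit_interval_ordered_iff_near_diagonal
    by (auto simp: unit_interval_pf_def)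
  ultimately show ?thesis using assms by (simp add: prime_pf_def length_unit_prime)
qed

text \<open>Having no breakpoint below the length keeps every entry at a positive index off the
  diagonal, so it equals its index; the first entry is squeezed to 1.\<close>

lemma prime_near_diagonal_eq_unit_prime:
  assumes nd: "near_diagonal P" and "prime_pf P"
  shows "1 \<le> length P" and "P = unit_prime (length P)"
proof -
  have bp: "{k. has_breakpoint P k} = {length P}" using assms(2) by (simp add: prime_pf_def)
  then have "has_breakpoint P (length P)" by blast
  then show len: "1 \<le> length P" by (simp add: has_breakpoint_def)
  show "P = unit_prime (length P)"
  proof (rule nth_equalityI)
    fix i assume i: "i < length P"
    have b: "1 \<le> P ! i \<and> i \<le> P ! i \<and> P ! i \<le> i + 1"
      using nd i by (simp add: near_diagonal_def)
    have "has_breakpoint P i \<longleftrightarrow> i = length P" using bp by blast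
    then have "\<not> has_breakpoint P i" using i by simp
    then have "i = 0 \<or> P ! i \<noteq> i + 1"
      using i by (simp add: has_breakpoint_near_diagonal[OF nd] Suc_le_eq)
    then show "P ! i = unit_prime (length P) ! i"
      using b i by (auto simp: nth_unit_prime)
  qed (rule length_unit_prime[OF len, symmetric])
qed

subsection \<open>Pipes\<close>

lemma pipes_simps [simp]: "pipes [] = []" "pipes (P # Ps) = P @ map (\<lambda>b. b + length P) (pipes Ps)"
  by (simp_all add: pipes_def pipe_def)

lemma pipes_append:
  "pipes (Ps @ Qs) = pipes Ps @ map (\<lambda>b. b + length (pipes Ps)) (pipes Qs)"
  by (induction Ps) (simp_all add: ac_simps)

text \<open>The shift that component \<open>j\<close>, counted from 0, receives in the pipe. For
  unit primes these numbers turn out to be \<open>b\<^sub>j\<close>.\<close>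

definition pipe_offset :: "nat list list \<Rightarrow> nat \<Rightarrow> nat" where
  "pipe_offset Ps j = length (pipes (take j Ps))"

lemma pipe_offset_0 [simp]: "pipe_offset Ps 0 = 0"
  by (simp add: pipe_offset_def)

lemma pipe_offset_length [simp]: "pipe_offset Ps (length Ps) = length (pipes Ps)"
  by (simp add: pipe_offset_def)

lemma pipe_offset_Suc:
  "j < length Ps \<Longrightarrow> pipe_offset Ps (Suc j) = pipe_offset Ps j + length (Ps ! j)"
  by (simp add: pipe_offset_def take_Suc_conv_app_nth pipes_append)

lemma pipes_split:
  assumes "j < length Ps"
  obtains Q where "pipes Ps = pipes (take j Ps) @ map (\<lambda>b. b + pipe_offset Ps j) (Ps ! j) @ Q"
proof -
  have "Ps = take j Ps @ Ps ! j # drop (Suc j) Ps" using id_take_nth_drop[OF assms] .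
  then have "pipes Ps = pipes (take j Ps @ Ps ! j # drop (Suc j) Ps)" by simp
  then show ?thesis using that by (simp add: pipes_append pipe_offset_def)
qed

lemma nth_pipes:
  assumes "j < length Ps" and "i < length (Ps ! j)"
  shows "pipe_offset Ps j + i < length (pipes Ps)"
    and "pipes Ps ! (pipe_offset Ps j + i) = Ps ! j ! i + pipe_offset Ps j"
proof -
  obtain Q where Q: "pipes Ps = pipes (take j Ps) @ map (\<lambda>b. b + pipe_offset Ps j) (Ps ! j) @ Q"
    using pipes_split[OF assms(1)] .
  have l: "length (pipes (take j Ps)) = pipe_offset Ps j" by (simp add: pipe_offset_def)
  show "pipe_offset Ps j + i < length (pipes Ps)" unfolding Q using assms(2) l by simp
  show "pipes Ps ! (pipe_offset Ps j + i) = Ps ! j ! i + pipe_offset Ps j"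
    unfolding Q using assms(2) l by (simp add: nth_append)
qed

text \<open>The blocks cover all positions: by induction on \<open>m\<close>, an index below offset
  \<open>m + 1\<close> lies below offset \<open>m\<close> or in block \<open>m\<close>.\<close>

lemma pipe_offset_cover:
  assumes "k < length (pipes Ps)"
  obtains j i where "j < length Ps" and "i < length (Ps ! j)" and "k = pipe_offset Ps j + i"
proof -
  have "\<exists>j i. j < m \<and> i < length (Ps ! j) \<and> k = pipe_offset Ps j + i"
    if "m \<le> length Ps" "k < pipe_offset Ps m" for m
    using that
  proof (induction m)
    case 0
    then show ?case by simp
  next
    case (Suc m)
    show ?case
    proof (cases "k < pipe_offset Ps m")
      case True
      then show ?thesis using Suc less_SucI by (meson Suc_leD)
    next
      case False
      then have "k - pipe_offset Ps m < length (Ps ! m) \<and>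
          k = pipe_offset Ps m + (k - pipe_offset Ps m)"
        using Suc.prems pipe_offset_Suc[of m Ps] by auto
      then show ?thesis by blast
    qed
  qed
  from this[of "length Ps"] assms that show ?thesis by auto
qed

text \<open>The pipe shifts indices and entries of a block by the same amount, which preserves the
  bounds relative to the diagonal.\<close>

lemma near_diagonal_pipes:
  assumes "\<forall>P \<in> set Ps. near_diagonal P"
  shows "near_diagonal (pipes Ps)"
  unfolding near_diagonal_def
proof (intro allI impI)
  fix k assume "k < length (pipes Ps)"
  then obtain j i where ji: "j < length Ps" "i < length (Ps ! j)" "k = pipe_offset Ps j + i"
    using pipe_offset_cover by metis
  have "near_diagonal (Ps ! j)" using assms ji(1) by simp
  then show "1 \<le> pipes Ps ! k \<and> k \<le> pipes Ps ! k \<and> pipes Ps ! k \<le> k + 1"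
    using ji by (auto simp: near_diagonal_def nth_pipes)
qed

text \<open>Induction on appending a last entry \<open>x\<close>. An entry on the diagonal opens a
  new block \<open>(1)\<close>; an entry just below it lengthens the last block by one.\<close>

lemma near_diagonal_eq_pipes_unit_primes:
  assumes "near_diagonal \<alpha>"
  shows "\<exists>Ps. \<alpha> = pipes Ps \<and> (\<forall>P \<in> set Ps. \<exists>r\<ge>1. P = unit_prime r)"
  using assms
proof (induction \<alpha> rule: rev_induct)
  case Nil
  then show ?case by (intro exI[of _ "[]"]) simp
next
  case (snoc x \<alpha>)
  have "near_diagonal \<alpha>"
    unfolding near_diagonal_def
  proof (intro allI impI)
    fix i assume "i < length \<alpha>"
    then show "1 \<le> \<alpha> ! i \<and> i \<le> \<alpha> ! i \<and> \<alpha> ! i \<le> i + 1"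
      using snoc.prems[unfolded near_diagonal_def, rule_format, of i] by (simp add: nth_append)
  qed
  then obtain Ps where Ps: "\<alpha> = pipes Ps" "\<forall>P \<in> set Ps. \<exists>r\<ge>1. P = unit_prime r"
    using snoc.IH by blast
  have x: "1 \<le> x" "length \<alpha> \<le> x" "x \<le> length \<alpha> + 1"
    using snoc.prems[unfolded near_diagonal_def, rule_format, of "length \<alpha>"] by simp_all
  show ?case
  proof (cases "x = length \<alpha> + 1")
    case True
    have "\<alpha> @ [x] = pipes (Ps @ [unit_prime 1])"
      using True Ps(1) by (simp add: pipes_append unit_prime_def)
    moreover have "\<forall>P \<in> set (Ps @ [unit_prime 1]). \<exists>r\<ge>1. P = unit_prime r"
      using Ps(2) by auto
    ultimately show ?thesis by blast
  next
    case False
    then have xl: "x = length \<alpha>" using x by simp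
    \<comment> \<open>Since \<open>x\<close> is positive and equals the length of
      \<open>\<alpha>\<close>, there is a last block to lengthen.\<close>
    then have "Ps \<noteq> []" using x(1) Ps(1) by auto
    then obtain Qs P where Q: "Ps = Qs @ [P]" by (metis rev_exhaust)
    then obtain r where r: "r \<ge> 1" "P = unit_prime r" using Ps(2) by auto
    \<comment> \<open>The new entry \<open>r\<close> is shifted by the length of
      \<open>pipes Qs\<close>, which gives the length of \<open>\<alpha>\<close>, that is
      \<open>x\<close>.\<close>
    have "unit_prime (Suc r) = unit_prime r @ [r]" using r(1) by (simp add: unit_prime_def)
    then have "\<alpha> @ [x] = pipes (Qs @ [unit_prime (Suc r)])"
      using xl Ps(1) Q r by (simp add: pipes_append length_unit_prime)
    moreover have "\<forall>P \<in> set (Qs @ [unit_prime (Suc r)]). \<exists>r\<ge>1. P = unit_prime r"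
      using Ps(2) Q by auto
    ultimately show ?thesis by blast
  qed
qed

section \<open>Breakpoints and component primes of a pipe of unit primes\<close>

context
  fixes Ps :: "nat list list"
  assumes unit_primes: "\<forall>P \<in> set Ps. \<exists>r\<ge>1. P = unit_prime r"
begin

lemma nth_unit_primes:
  assumes "j < length Ps"
  shows "1 \<le> length (Ps ! j)" and "Ps ! j = unit_prime (length (Ps ! j))"
proof -
  obtain r where "r \<ge> 1" "Ps ! j = unit_prime r" using unit_primes nth_mem[OF assms] by blast
  then show "1 \<le> length (Ps ! j)" and "Ps ! j = unit_prime (length (Ps ! j))"
    by (simp_all add: length_unit_prime)
qed

lemma nth_nth_unit_primes:
  assumes "j < length Ps" and "i < length (Ps ! j)"
  shows "Ps ! j ! i = (if i = 0 then 1 else i)"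
  using nth_unit_primes(2)[OF assms(1)] nth_unit_prime[OF assms(2)] by metis

text \<open>Unit primes are non-empty, so each block moves the offset forward. This lets the offsets
  be identified with a sorted list of breakpoints.\<close>

lemma pipe_offset_strict_mono:
  assumes "i < j" and "j \<le> length Ps"
  shows "pipe_offset Ps i < pipe_offset Ps j"
  using assms
proof (induction j)
  case 0
  then show ?case by simp
next
  case (Suc j)
  have "pipe_offset Ps j < pipe_offset Ps (Suc j)"
    using nth_unit_primes(1)[of j] pipe_offset_Suc[of j Ps] Suc.prems by linarith
  then show ?case using Suc by (cases "i = j") auto
qed

text \<open>A breakpoint below the length is a positive index whose entry lies on the diagonal.
  Within a unit prime only local index 0 has this property, so these breakpoints are the starts of
  the blocks after the first; the end of the last block is the total length.\<close>

lemma has_breakpoint_pipes_unit_primes: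
  "has_breakpoint (pipes Ps) k \<longleftrightarrow> (\<exists>j \<in> {1..length Ps}. k = pipe_offset Ps j)"
proof -
  have nd: "near_diagonal (pipes Ps)"
    using unit_primes near_diagonal_unit_prime by (intro near_diagonal_pipes) auto
  show ?thesis
  proof
    assume "has_breakpoint (pipes Ps) k"
    then have k: "1 \<le> k" "k \<le> length (pipes Ps)" "k = length (pipes Ps) \<or> pipes Ps ! k = k + 1"
      by (auto simp: has_breakpoint_near_diagonal[OF nd])
    show "\<exists>j \<in> {1..length Ps}. k = pipe_offset Ps j"
    proof (cases "k = length (pipes Ps)")
      case True
      then have "Ps \<noteq> []" using k(1) by auto
      then show ?thesis using True by (intro bexI[of _ "length Ps"]) (simp_all add: Suc_le_eq)
    next
      case False
      then have "k < length (pipes Ps)" using k by simp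
      then obtain j i where ji: "j < length Ps" "i < length (Ps ! j)" "k = pipe_offset Ps j + i"
        using pipe_offset_cover by metis
      have "Ps ! j ! i = i + 1" using k(3) False ji nth_pipes(2)[OF ji(1,2)] by simp
      moreover have "Ps ! j ! i = (if i = 0 then 1 else i)"
        by (rule nth_nth_unit_primes[OF ji(1,2)])
      ultimately have "i = 0" by (simp split: if_splits)
      then have "k = pipe_offset Ps j" using ji(3) by simp
      moreover from this have "j \<noteq> 0" using k(1) by (cases j) auto
      ultimately show ?thesis using ji(1) by auto
    qed
  next
    assume "\<exists>j \<in> {1..length Ps}. k = pipe_offset Ps j"
    then obtain j where j: "1 \<le> j" "j \<le> length Ps" "k = pipe_offset Ps j" by auto
    have "1 \<le> k" using pipe_offset_strict_mono[of 0 j] j by simp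
    show "has_breakpoint (pipes Ps) k"
    proof (cases "j = length Ps")
      case True
      then show ?thesis using j \<open>1 \<le> k\<close> by (simp add: has_breakpoint_near_diagonal[OF nd])
    next
      case False
      then have jl: "j < length Ps" using j by simp
      have l: "0 < length (Ps ! j)" using nth_unit_primes(1)[OF jl] by linarith
      have "Ps ! j ! 0 = 1" using nth_nth_unit_primes[OF jl l] by simp
      then show ?thesis
        using nth_pipes[OF jl l] j \<open>1 \<le> k\<close> by (simp add: has_breakpoint_near_diagonal[OF nd])
    qed
  qed
qed

text \<open>The increasing list of offsets from index 1 on is the sorted list of breakpoints, and
  the leading 0 of \<open>breaks\<close> is the offset of the first block.\<close>

lemma breaks_pipes_unit_primes: "breaks (pipes Ps) = map (pipe_offset Ps) [0..<length Ps + 1]"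
proof -
  let ?xs = "map (pipe_offset Ps) [1..<length Ps + 1]"
  have "sorted_wrt (<) ?xs"
    unfolding sorted_wrt_map
    by (rule sorted_wrt_mono_rel[OF _ sorted_wrt_upt]) (auto intro: pipe_offset_strict_mono)
  then have "sorted_list_of_set (set ?xs) = ?xs"
    by (simp add: sorted_list_of_set.idem_if_sorted_distinct strict_sorted_iff del: set_map)
  moreover have "{k. has_breakpoint (pipes Ps) k} = set ?xs"
    by (auto simp: has_breakpoint_pipes_unit_primes)
  ultimately have "breaks (pipes Ps) = 0 # ?xs" by (simp add: breaks_def)
  then show ?thesis by (simp add: upt_conv_Cons del: upt_Suc)
qed

lemma num_breakpoints_pipes_unit_primes: "num_breakpoints (pipes Ps) = length Ps"
  using length_breaks[of "pipes Ps"] by (simp add: breaks_pipes_unit_primes)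

lemma nth_breaks_pipes_unit_primes:
  "j \<le> length Ps \<Longrightarrow> breaks (pipes Ps) ! j = pipe_offset Ps j"
  by (simp add: breaks_pipes_unit_primes del: upt_Suc)

text \<open>Cutting at the breakpoints cuts at the block boundaries, and the subtraction cancels the
  shift of the pipe. The components are thus recovered from the pipe, which is what makes
  decompositions unique.\<close>

lemma ordered_component_primes_pipes_unit_primes: "ordered_component_primes (pipes Ps) = Ps"
proof (rule nth_equalityI)
  show "length (ordered_component_primes (pipes Ps)) = length Ps"
    by (simp add: ordered_component_primes_def num_breakpoints_pipes_unit_primes)
  fix j assume "j < length (ordered_component_primes (pipes Ps))"
  then have j: "j < length Ps"
    by (simp add: ordered_component_primes_def num_breakpoints_pipes_unit_primes)
  have "ordered_component_primes (pipes Ps) ! j =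
      map (\<lambda>i. pipes Ps ! i - pipe_offset Ps j) [pipe_offset Ps j..<pipe_offset Ps (Suc j)]"
    using j by (simp add: ordered_component_primes_def num_breakpoints_pipes_unit_primes
        nth_breaks_pipes_unit_primes)
  also have "\<dots> = Ps ! j"
    by (rule nth_equalityI) (simp_all add: pipe_offset_Suc j nth_pipes(2))
  finally show "ordered_component_primes (pipes Ps) ! j = Ps ! j" .
qed

end

subsection \<open>Decompositions\<close>

text \<open>One direction cuts a pipe of unit primes back into its blocks. For the other, every
  index lies in some component, whose shape yields the missing lower bound
  \<open>i \<le> \<beta> ! i\<close>. The intended \<open>\<beta>\<close> is a parking
  rearrangement.\<close>

lemma near_diagonal_iff_component_primes:
  assumes bounds: "\<forall>i < length \<beta>. 1 \<le> \<beta> ! i \<and> \<beta> ! i \<le> i + 1"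
  shows "near_diagonal \<beta> \<longleftrightarrow> (\<forall>P \<in> set (ordered_component_primes \<beta>). P = unit_prime (length P))"
proof
  assume "near_diagonal \<beta>"
  then obtain Ps where Ps: "\<beta> = pipes Ps" "\<forall>P \<in> set Ps. \<exists>r\<ge>1. P = unit_prime r"
    using near_diagonal_eq_pipes_unit_primes by blast
  then show "\<forall>P \<in> set (ordered_component_primes \<beta>). P = unit_prime (length P)"
    using ordered_component_primes_pipes_unit_primes[OF Ps(2)] length_unit_prime by auto
next
  assume *: "\<forall>P \<in> set (ordered_component_primes \<beta>). P = unit_prime (length P)"
  show "near_diagonal \<beta>"
    unfolding near_diagonal_def
  proof (intro allI impI)
    fix i assume i: "i < length \<beta>"
    have "\<forall>i < length \<beta>. \<beta> ! i \<le> length \<beta>" using bounds by fastforce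
    then obtain j where j: "j < num_breakpoints \<beta>" "breaks \<beta> ! j \<le> i" "i < breaks \<beta> ! (j + 1)"
      using between_breaks[OF _ i] by blast
    let ?b = "breaks \<beta> ! j" and ?c = "breaks \<beta> ! (j + 1)"
    let ?P = "map (\<lambda>i. \<beta> ! i - ?b) [?b..<?c]"
    have "?P \<in> set (ordered_component_primes \<beta>)"
      using j(1) by (auto simp: ordered_component_primes_def)
    then have "?P = unit_prime (length ?P)" using * by blast
    then have "?P = unit_prime (?c - ?b)" by (simp only: length_map length_upt)
    then have "?P ! (i - ?b) = unit_prime (?c - ?b) ! (i - ?b)" by (rule arg_cong)
    then have "\<beta> ! i - ?b = (if i - ?b = 0 then 1 else i - ?b)"
      using j by (auto simp: nth_unit_prime)
    \<comment> \<open>The right-hand side is positive, so the subtraction did not truncate: the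
      entry is \<open>i + 1\<close> at the start of the block and \<open>i\<close>
      elsewhere.\<close>
    then have "i \<le> \<beta> ! i" using j by (auto split: if_splits)
    then show "1 \<le> \<beta> ! i \<and> i \<le> \<beta> ! i \<and> \<beta> ! i \<le> i + 1" using bounds i by blast
  qed
qed

text \<open>The components of a decomposition inherit parking order from \<open>\<alpha>\<close>,
  because index and entry are shifted alike. They are then near the diagonal, and primality forces
  them to be unit primes.\<close>

lemma prime_upf_decomposition_ordered_iff:
  assumes "parking_ordered \<alpha>"
  shows "prime_upf_decomposition \<alpha> Ps \<longleftrightarrow>
    \<alpha> = pipes Ps \<and> (\<forall>P \<in> set Ps. \<exists>r\<ge>1. P = unit_prime r)"
proof
  assume d: "prime_upf_decomposition \<alpha> Ps"
  then have eq: "\<alpha> = pipes Ps" by (simp add: prime_upf_decomposition_def)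
  have "\<exists>r\<ge>1. P = unit_prime r" if P: "P \<in> set Ps" for P
  proof -
    have pu: "prime_pf P" "unit_interval_pf P"
      using d P by (simp_all add: prime_upf_decomposition_def)
    obtain j where j: "j < length Ps" "P = Ps ! j" using P by (auto simp: in_set_conv_nth)
    have "P ! i \<le> i + 1" if i: "i < length P" for i
    proof -
      have "pipes Ps ! (pipe_offset Ps j + i) \<le> pipe_offset Ps j + i + 1"
        using assms eq nth_pipes(1)[of j Ps i] j i by (simp add: parking_ordered_def)
      then show ?thesis using nth_pipes(2)[of j Ps i] j i by simp
    qed
    then have "near_diagonal P"
      using pu(2) by (simp add: parking_ordered_def flip: unit_interval_ordered_iff_near_diagonal)
    then show ?thesis using prime_near_diagonal_eq_unit_prime pu(1) by blast
  qed
  with eq show "\<alpha> = pipes Ps \<and> (\<forall>P \<in> set Ps. \<exists>r\<ge>1. P = unit_prime r)" by blast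
next
  have "unit_interval_pf (unit_prime r)" if "1 \<le> r" for r
    using near_diagonal_unit_prime[OF that] by (simp flip: unit_interval_ordered_iff_near_diagonal)
  moreover assume "\<alpha> = pipes Ps \<and> (\<forall>P \<in> set Ps. \<exists>r\<ge>1. P = unit_prime r)"
  ultimately show "prime_upf_decomposition \<alpha> Ps"
    by (auto simp: prime_upf_decomposition_def prime_pf_unit_prime)
qed

theorem theorem2p8:
  "(\<forall>\<alpha> :: nat list. unit_interval_pf \<alpha> \<and> parking_ordered \<alpha> \<longrightarrow>
      (let n = length \<alpha>; b = breaks \<alpha>; k = num_breakpoints \<alpha> in
         b ! k = n \<and>
         (\<exists>!Ps. prime_upf_decomposition \<alpha> Ps) \<and>
         (\<forall>Ps. prime_upf_decomposition \<alpha> Ps \<longrightarrow>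
            length Ps = k \<and>
            (\<forall>j \<in> {1..k}. length (Ps ! (j - 1)) = b ! j - b ! (j - 1) \<and>
                           Ps ! (j - 1) = unit_prime (b ! j - b ! (j - 1)))))) \<and>
   (\<forall>\<alpha> :: nat list. unit_interval_pf \<alpha> \<longleftrightarrow>
      parking_function \<alpha> \<and> (\<forall>P \<in> set (component_primes \<alpha>). P = unit_prime (length P)))"
proof (intro conjI allI impI)
  fix \<alpha> :: "nat list"
  assume u: "unit_interval_pf \<alpha> \<and> parking_ordered \<alpha>"
  note iff = prime_upf_decomposition_ordered_iff[OF conjunct2[OF u]]
  obtain Ps where Ps: "\<alpha> = pipes Ps" "\<forall>P \<in> set Ps. \<exists>r\<ge>1. P = unit_prime r"
    using u near_diagonal_eq_pipes_unit_primes unit_interval_ordered_iff_near_diagonal by blast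
  \<comment> \<open>Both lists consist of unit primes, so each equals
    \<open>ordered_component_primes \<alpha>\<close>.\<close>
  have unique: "Qs = Ps" if "prime_upf_decomposition \<alpha> Qs" for Qs
  proof -
    have Qs: "\<alpha> = pipes Qs" "\<forall>P \<in> set Qs. \<exists>r\<ge>1. P = unit_prime r" using that iff by blast+
    show ?thesis
      using ordered_component_primes_pipes_unit_primes[OF Qs(2)]
        ordered_component_primes_pipes_unit_primes[OF Ps(2)] Qs(1) Ps(1) by simp
  qed
  have ex1: "\<exists>!Ps. prime_upf_decomposition \<alpha> Ps"
    using Ps unique iff by blast
  have k: "num_breakpoints \<alpha> = length Ps"
    using num_breakpoints_pipes_unit_primes[OF Ps(2)] Ps(1) by simp
  have b: "breaks \<alpha> ! j = pipe_offset Ps j" if "j \<le> length Ps" for j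
    using nth_breaks_pipes_unit_primes[OF Ps(2) that] Ps(1) by simp
  \<comment> \<open>Components are numbered from 1 here and list positions from 0; consecutive
    offsets differ by the length of the block between them.\<close>
  have len: "length (Ps ! (j - 1)) = breaks \<alpha> ! j - breaks \<alpha> ! (j - 1)" if "j \<in> {1..length Ps}" for j
    using that b[of j] b[of "j - 1"] pipe_offset_Suc[of "j - 1" Ps] by auto
  have up: "Ps ! (j - 1) = unit_prime (breaks \<alpha> ! j - breaks \<alpha> ! (j - 1))" if "j \<in> {1..length Ps}" for j
  proof -
    have "j - 1 < length Ps" using that by auto
    from nth_unit_primes(2)[OF Ps(2) this] show ?thesis unfolding len[OF that] .
  qed
  have n: "breaks \<alpha> ! length Ps = length \<alpha>" using b[of "length Ps"] Ps(1) by simp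
  show "let n = length \<alpha>; b = breaks \<alpha>; k = num_breakpoints \<alpha> in
         b ! k = n \<and>
         (\<exists>!Ps. prime_upf_decomposition \<alpha> Ps) \<and>
         (\<forall>Ps. prime_upf_decomposition \<alpha> Ps \<longrightarrow>
            length Ps = k \<and>
            (\<forall>j \<in> {1..k}. length (Ps ! (j - 1)) = b ! j - b ! (j - 1) \<and>
                           Ps ! (j - 1) = unit_prime (b ! j - b ! (j - 1))))"
    unfolding Let_def k using n ex1 unique len up by blast
next
  fix \<alpha> :: "nat list"
  show "unit_interval_pf \<alpha> \<longleftrightarrow>
      parking_function \<alpha> \<and> (\<forall>P \<in> set (component_primes \<alpha>). P = unit_prime (length P))"
  \<comment> \<open>Both sides fail unless \<open>\<alpha>\<close> is a parking function; if it is,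
    both amount to the rearrangement being near the diagonal.\<close>
  proof (cases "parking_function \<alpha>")
    case True
    have "\<forall>j < length (parking_rearrangement \<alpha>).
        1 \<le> parking_rearrangement \<alpha> ! j \<and> parking_rearrangement \<alpha> ! j \<le> j + 1"
      using parking_rearrangement_bounds[OF True] by simp
    from near_diagonal_iff_component_primes[OF this] show ?thesis
      using True unit_interval_iff_near_diagonal_rearrangement[OF True]
      by (simp add: component_primes_def)
  next
    case False
    then show ?thesis by (simp add: unit_interval_pf_def)
  qed
qed

end
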